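(* Let $\mathsf K_r(\alpha)=\tfrac{\pi}{2}\,{}_2F_1(\tfrac1r,1-\tfrac1r;1;\alpha)$ for $0<\alpha<1$, and $\mathsf K_r'(\alpha)=\mathsf K_r(1-\alpha)$ (not a derivative). Below $f\circ g$ denotes $f(g(t))$. The following identities hold for all $t>0$; moreover, in each identity labelled by $(r,N)$, if $\alpha$ and $\beta$ denote the arguments of $\mathsf K_r$ on the left and right sides, then $\alpha,\beta$ satisfy the degree-$N$ relation $\mathsf K_r'(\beta)/\mathsf K_r(\beta)=N\,\mathsf K_r'(\alpha)/\mathsf K_r(\alpha)$. $r=2$: $N=2$: $\mathsf K_2\bigl(\frac{t(t+8)}{(t+4)^2}\bigr)=2\bigl[\frac{t+4}{t+8}\bigr]\mathsf K_2\bigl(\frac{t^2}{(t+8)^2}\bigr)$. $N=3$: $\mathsf K_2\bigl(\frac{t(t+4)^3}{(t+2)^3(t+6)}\bigr)=3\bigl[\frac{t+2}{t+6}\bigr]\mathsf K_2\bigl(\frac{t^3(t+4)}{(t+2)(t+6)^3}\bigr)$. $N=4$: $\mathsf K_2\bigl(\frac{t(t+8)}{(t+4)^2}\circ t(t+4)\bigr)=4\bigl[\frac{t+2}{t+4}\bigr]^2\mathsf K_2\bigl(\frac{t^2}{(t+8)^2}\circ\frac{t^2}{t+2}\bigr)$. $r=3$: $N=2$: $\mathsf K_3\bigl(\frac{t(t+9)^2}{(t+6)^3}\bigr)=2\bigl[\frac{t+6}{t+12}\bigr]\mathsf K_3\bigl(\frac{t^2(t+9)}{(t+12)^3}\bigr)$.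 $N=3$: $\mathsf K_3\bigl(\frac{t(t^2+9t+27)}{(t+3)^3}\bigr)=3\bigl[\frac{t+3}{t+9}\bigr]\mathsf K_3\bigl(\frac{t^3}{(t+9)^3}\bigr)$. $N=4$: $\mathsf K_3\bigl(\frac{t(t+9)^2}{(t+6)^3}\circ t(t+6)\bigr)=4\bigl[\frac{t^2+6t+6}{t^2+12t+24}\bigr]\mathsf K_3\bigl(\frac{t^2(t+9)}{(t+12)^3}\circ\frac{t^2}{t+2}\bigr)$. $N=6$: $\mathsf K_3\bigl(\frac{t(t+9)^2}{(t+6)^3}\circ t(t^2+6t+12)=\frac{t(t^2+9t+27)}{(t+3)^3}\circ\frac{t(t+3)^2}{t+2}\bigr)=6\bigl[\frac{t^3+6t^2+12t+6}{t^3+12t^2+36t+36}\bigr]\mathsf K_3\bigl(\frac{t^2(t+9)}{(t+12)^3}\circ\frac{t^3}{t^2+3t+3}=\frac{t^3}{(t+9)^3}\circ\frac{t^2(t+3)}{(t+2)^2}\bigr)$. $r=4$: $N=2$: $\mathsf K_4\bigl(\frac{t(t+16)}{(t+8)^2}\bigr)=2\bigl[\frac{t+8}{t+32}\bigr]^{1/2}\mathsf K_4\bigl(\frac{t^2}{(t+32)^2}\bigr)$. $N=3$: $\mathsf K_4\bigl(\frac{t(t+8)^3}{(t^2+12t+24)^2}\bigr)=3\bigl[\frac{t^2+12t+24}{t^2+36t+216}\bigr]^{1/2}\mathsf K_4\bigl(\frac{t^3(t+8)}{(t^2+36t+216)^2}\bigr)$. $N=4$: $\mathsf K_4\bigl(\frac{t(t+16)}{(t+8)^2}\circ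 t(t+8)\bigr)=4\bigl[\frac{t^2+8t+8}{t^2+32t+128}\bigr]^{1/2}\mathsf K_4\bigl(\frac{t^2}{(t+32)^2}\circ\frac{t^2}{t+4}\bigr)$. $N=5$: $\mathsf K_4\bigl(\frac{t(t+4)^5}{(t^2+6t+4)^2(t^2+8t+20)}\bigr)=5\bigl[\frac{t^2+6t+4}{t^2+30t+100}\bigr]^{1/2}\mathsf K_4\bigl(\frac{t^5(t+4)}{(t^2+8t+20)(t^2+30t+100)^2}\bigr)$. $N=6$: $\mathsf K_4\bigl(\frac{t(t+16)}{(t+8)^2}\circ\frac{t(t+4)^3}{t+3}=\frac{t(t+8)^3}{(t^2+12t+24)^2}\circ t(t+6)\bigr)=6\bigl[\frac{t^4+12t^3+48t^2+72t+24}{t^4+36t^3+288t^2+864t+864}\bigr]^{1/2}\mathsf K_4\bigl(\frac{t^2}{(t+32)^2}\circ\frac{t^3(t+4)}{(t+3)^3}=\frac{t^3(t+8)}{(t^2+36t+216)^2}\circ\frac{t^2}{t+2}\bigr)$. $N=8$: $\mathsf K_4\bigl(\frac{t(t+16)}{(t+8)^2}\circ t(t+8)\circ t(t+4)\bigr)=8\bigl[\frac{t^4+8t^3+24t^2+32t+8}{t^4+32t^3+192t^2+512t+512}\bigr]^{1/2}\mathsf K_4\bigl(\frac{t^2}{(t+32)^2}\circ\frac{t^2}{t+4}\circ\frac{t^2}{t+2}\bigr)$. $N=9$: $\mathsf K_4\bigl(\frac{t(t+8)^3}{(t^2+12t+24)^2}\circ t(t^2+6t+12)\bigr)=9\bigl[\frac{t^6+12t^5+60t^4+156t^3+216t^2+144t+24}{t^6+36t^5+324t^4+1404t^3+3240t^2+3888t+1944}\bigr]^{1/2}\mathsf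 K_4\bigl(\frac{t^3(t+8)}{(t^2+36t+216)^2}\circ\frac{t^3}{t^2+3t+3}\bigr)$. In addition, the following two identities hold for all $t>0$, and are of degree $N=\tfrac32$ (i.e. their arguments satisfy $\mathsf K_r'(\beta)/\mathsf K_r(\beta)=\tfrac32\,\mathsf K_r'(\alpha)/\mathsf K_r(\alpha)$ with $r=3$, $r=4$ respectively): $$\mathsf K_3\Bigl(\tfrac{t(t^2+9t+27)}{(t+3)^3}\circ\tfrac{t^2(t+3)}{(t+2)^2}=\tfrac{t^2(t+9)}{(t+12)^3}\circ t(t^2+6t+12)\Bigr)=\tfrac32\Bigl[\tfrac{t^3+6t^2+12t+12}{t^3+6t^2+18t+18}\Bigr]\mathsf K_3\Bigl(\tfrac{t^3}{(t+9)^3}\circ\tfrac{t(t+3)^2}{t+2}=\tfrac{t(t+9)^2}{(t+6)^3}\circ\tfrac{t^3}{t^2+3t+3}\Bigr),$$ $$\mathsf K_4\Bigl(\tfrac{t^2}{(t+32)^2}\circ\tfrac{t(t+4)^3}{t+3}=\tfrac{t(t+8)^3}{(t^2+12t+24)^2}\circ\tfrac{t^2}{t+2}\Bigr)=\tfrac32\Bigl[\tfrac{t^4+12t^3+48t^2+96t+96}{t^4+12t^3+72t^2+216t+216}\Bigr]^{1/2}\mathsf K_4\Bigl(\tfrac{t(t+16)}{(t+8)^2}\circ\tfrac{t^3(t+4)}{(t+3)^3}=\tfrac{t^3(t+8)}{(t^2+36t+216)^2}\circ t(t+6)\Bigr).$$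
   Context: ${}_2F_1$ is the Gauss hypergeometric function. An expression "$\mathsf K_r(A=B)$" means that the two rational functions $A$ and $B$ of $t$ coincide, and $\mathsf K_r$ is evaluated at their common value. Square roots of positive quantities are positive. *)

theory Defs
  imports "HOL-Analysis.Analysis"
begin

text \<open>
  The power series, hence the Gauss hypergeometric function only for \<open>\<bar>z\<bar> < 1\<close>; no analytic
  continuation is involved. The third argument of \<open>fps_hypergeo\<close> is a scale factor for \<open>z\<close>.
\<close>
definition hyp2F1 :: "real \<Rightarrow> real \<Rightarrow> real \<Rightarrow> real \<Rightarrow> real" where
  "hyp2F1 a b c z = eval_fps (fps_hypergeo [a, b] [c] 1) z"

definition K :: "nat \<Rightarrow> real \<Rightarrow> real" where
  "K r \<alpha> = pi / 2 * hyp2F1 (1 / real r) (1 - 1 / real r) 1 \<alpha>"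

text \<open>The complementary function; the prime does not denote a derivative.\<close>
definition K' :: "nat \<Rightarrow> real \<Rightarrow> real" where
  "K' r \<alpha> = K r (1 - \<alpha>)"

definition degree_relation :: "nat \<Rightarrow> real \<Rightarrow> real \<Rightarrow> real \<Rightarrow> bool" where
  "degree_relation r N \<alpha> \<beta> \<longleftrightarrow> K' r \<beta> / K r \<beta> = N * (K' r \<alpha> / K r \<alpha>)"

text \<open>
  \<open>A\<close> and \<open>B\<close> are the arguments of \<open>K r\<close> on the left and right, and \<open>M\<close> is the factor next to
  \<open>N\<close>, including its exponent. Since \<open>K r\<close> is meant as a function on the open unit interval, the
  identity includes the assertion that its arguments lie there.
\<close>
definition modular_identity ::
    "nat \<Rightarrow> real \<Rightarrow> (real \<Rightarrow> real) \<Rightarrow> (real \<Rightarrow> real) \<Rightarrow> (real \<Rightarrow> real) \<Rightarrow> bool" where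
  "modular_identity r N A M B \<longleftrightarrow>
     (\<forall>t>0. 0 < A t \<and> A t < 1 \<and> 0 < B t \<and> B t < 1 \<and>
            K r (A t) = N * M t * K r (B t) \<and>
            degree_relation r N (A t) (B t))"

text \<open>
  Coincidence of two rational functions, compared on the half-line where all identities live.
  All rational functions compared below are free of poles there, so that this is the same as
  equality in the field of rational functions.
\<close>
definition coincide :: "(real \<Rightarrow> real) \<Rightarrow> (real \<Rightarrow> real) \<Rightarrow> bool" where
  "coincide f g \<longleftrightarrow> (\<forall>t>0. f t = g t)"

end

theory Submission
  imports Defs
begin

text \<open>
  If \<open>y\<close> solves the hypergeometric equation \<open>(x(1 - x)y')' = c y\<close>, \<open>c = (r - 1)/r\<^sup>2\<close>, then \<open>F = K(\<alpha>)\<close>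
  and \<open>G = M K(\<beta>)\<close>, as functions of \<open>t\<close>, satisfy the same self-adjoint second-order equation with
  leading coefficient \<open>q = \<alpha>(1 - \<alpha>)/\<alpha>'\<close>. Hence the Wronskian \<open>q(FG' - F'G)\<close> is constant; it vanishes at
  \<open>t = 0\<close> because \<open>q\<close> does, so \<open>G/F\<close> is constant and equals its value \<open>M(0) = 1/N\<close> at \<open>0\<close>.
  The degree relation is the same identity read at \<open>d/t\<close> for a suitable constant \<open>d\<close>: the
  involution \<open>t \<mapsto> d/t\<close> sends \<open>\<beta>\<close> to \<open>1 - \<alpha>\<close>, \<open>\<alpha>\<close> to \<open>1 - \<beta>\<close> and \<open>M\<close> to \<open>1/(N M)\<close>.
  This yields the identities of degree 2, 3 and 5; the others follow by substitution,
  composition and division.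
\<close>

section \<open>The hypergeometric series with parameters a, 1 - a; 1 and its differential
  equation\<close>

lemma hypergeo_coeff_Suc:
  fixes a b :: real
  shows "fps_nth (fps_hypergeo [a, b] [1] 1) (Suc n)
    = (a + real n) * (b + real n) / (real (Suc n))\<^sup>2 * fps_nth (fps_hypergeo [a, b] [1] 1) n"
  unfolding fps_hypergeo_rec by (simp add: power2_eq_square add.commute)

text \<open>For a in [0, 1] both a + n and 1 - a + n lie between 0 and n + 1, so each coefficient
  ratio lies in [0, 1]. The upper bound gives convergence on the open unit interval, the lower one
  the positivity of \<open>K\<close>.\<close>

lemma hypergeo_coeff_bounds:
  fixes a :: real
  assumes "0 \<le> a" "a \<le> 1"
  shows "0 \<le> fps_nth (fps_hypergeo [a, 1 - a] [1] 1) n \<and> fps_nth (fps_hypergeo [a, 1 - a] [1] 1) n \<le> 1"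
proof (induction n)
  case (Suc n)
  have "(a + real n) * (1 - a + real n) \<le> real (Suc n) * real (Suc n)"
    using assms by (intro mult_mono) auto
  moreover have "0 \<le> (a + real n) * (1 - a + real n)" using assms by simp
  ultimately have *: "0 \<le> (a + real n) * (1 - a + real n) / (real (Suc n))\<^sup>2"
      "(a + real n) * (1 - a + real n) / (real (Suc n))\<^sup>2 \<le> 1"
    by (simp_all add: power2_eq_square divide_le_eq)
  show ?case
    unfolding hypergeo_coeff_Suc using mult_nonneg_nonneg[OF *(1)] mult_le_one[OF *(2)] Suc by blast
qed simp

lemma hypergeo_conv_radius:
  fixes a :: real
  assumes "0 \<le> a" "a \<le> 1"
  shows "fps_conv_radius (fps_hypergeo [a, 1 - a] [1] 1) \<ge> 1"
  unfolding fps_conv_radius_def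
proof (rule conv_radius_geI_ex')
  fix s :: real assume s: "0 < s" "ereal s < 1"
  show "summable (\<lambda>n. fps_nth (fps_hypergeo [a, 1 - a] [1] 1) n * of_real s ^ n)"
  proof (rule summable_comparison_test')
    show "summable (\<lambda>n. s ^ n)" using s by (simp add: summable_geometric one_ereal_def)
    show "norm (fps_nth (fps_hypergeo [a, 1 - a] [1] 1) n * of_real s ^ n) \<le> s ^ n" for n
      using hypergeo_coeff_bounds[OF assms, of n] s
      by (simp add: abs_mult mult_left_le_one_le del: fps_hypergeo_nth)
  qed
qed

text \<open>The numerator parameters add up to 1, so (a + n)(1 - a + n) = n(n + 1) + a(1 - a): the
  recurrence splits into a self-adjoint operator and a constant multiple of
  \<open>h\<close>.\<close>

lemma hypergeo_ode_fps:
  fixes a :: real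
  defines "h \<equiv> fps_hypergeo [a, 1 - a] [1] 1"
  shows "fps_deriv (fps_X * (1 - fps_X) * fps_deriv h) = fps_const (a * (1 - a)) * h"
proof (rule fps_ext)
  fix n
  have "fps_nth h (Suc n) * (real (Suc n))\<^sup>2 = (a + real n) * (1 - a + real n) * fps_nth h n"
    unfolding h_def hypergeo_coeff_Suc by (simp del: fps_hypergeo_nth)
  moreover have "fps_X * (1 - fps_X) * fps_deriv h
      = fps_X * fps_deriv h - fps_X * (fps_X * fps_deriv h)"
    by (simp add: algebra_simps)
  then have "fps_nth (fps_deriv (fps_X * (1 - fps_X) * fps_deriv h)) n
      = real (Suc n) * (real (Suc n) * fps_nth h (Suc n) - real n * fps_nth h n)"
    \<comment> \<open>One factor X shifts the index n + 1 back to n, the second one to n - 1, which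
      makes n = 0 a separate case.\<close>
    by (cases n) (simp_all only: fps_deriv_nth fps_sub_nth fps_X_mult_nth, simp_all)
  ultimately show "fps_nth (fps_deriv (fps_X * (1 - fps_X) * fps_deriv h)) n
      = fps_nth (fps_const (a * (1 - a)) * h) n"
    by (simp add: algebra_simps power2_eq_square)
qed

lemma K_eq_eval_fps:
  "K r x = pi / 2 * eval_fps (fps_hypergeo [1 / real r, 1 - 1 / real r] [1] 1) x"
  by (simp add: K_def hyp2F1_def)

lemma
  assumes r: "r \<ge> 1" and x: "\<bar>x\<bar> < 1"
  shows K_has_derivative: "(K r has_real_derivative deriv (K r) x) (at x)"
    and K_ode: "((\<lambda>x. x * (1 - x) * deriv (K r) x) has_real_derivative
           (real r - 1) / (real r)\<^sup>2 * K r x) (at x)"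
proof -
  define a where "a = 1 / real r"
  define h where "h = fps_hypergeo [a, 1 - a] [1] 1"
  have a: "0 \<le> a" "a \<le> 1" using r by (auto simp: a_def)
  have h: "fps_conv_radius h \<ge> 1" unfolding h_def by (rule hypergeo_conv_radius[OF a])
  then have h': "fps_conv_radius (fps_deriv h) \<ge> 1"
    by (rule order_trans[OF _ fps_conv_radius_deriv])
  have K: "K r = (\<lambda>x. pi / 2 * eval_fps h x)" by (auto simp: K_eq_eval_fps h_def a_def)
  have dK: "(K r has_real_derivative pi / 2 * eval_fps (fps_deriv h) y) (at y)" if "\<bar>y\<bar> < 1" for y
    unfolding K using that less_le_trans[OF _ h, of "ereal \<bar>y\<bar>"]
    by (intro DERIV_cmult has_field_derivative_eval_fps) (simp add: one_ereal_def)
  then have deriv: "deriv (K r) y = pi / 2 * eval_fps (fps_deriv h) y" if "\<bar>y\<bar> < 1" for y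
    using that by (intro DERIV_imp_deriv)
  show "(K r has_real_derivative deriv (K r) x) (at x)" using dK[OF x] by (simp only: deriv[OF x])
  \<comment> \<open>\<open>p\<close> is x(1 - x)h'(x) as a formal series, so that
    \<open>hypergeo_ode_fps\<close> gives its derivative and no second derivative of
    \<open>K r\<close> has to be handled.\<close>
  define p where "p = fps_X * (1 - fps_X) * fps_deriv h"
  have X1: "fps_conv_radius (fps_X * (1 - fps_X) :: real fps) = \<infinity>"
    using fps_conv_radius_mult[of fps_X "1 - fps_X :: real fps"]
      fps_conv_radius_diff[of 1 "fps_X :: real fps"] by simp
  have p: "fps_conv_radius p \<ge> 1"
    unfolding p_def using fps_conv_radius_mult[of "fps_X * (1 - fps_X)" "fps_deriv h"] X1 h'
    by (simp add: order_trans)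
  have eval_p: "eval_fps p y = y * (1 - y) * eval_fps (fps_deriv h) y" if "\<bar>y\<bar> < 1" for y
  proof -
    have "ereal \<bar>y\<bar> < fps_conv_radius (fps_deriv h)"
      using that less_le_trans[OF _ h', of "ereal \<bar>y\<bar>"] by (simp add: one_ereal_def)
    moreover have "fps_conv_radius (1 - fps_X :: real fps) = \<infinity>"
      using fps_conv_radius_diff[of 1 "fps_X :: real fps"] by simp
    ultimately show ?thesis
      unfolding p_def using X1 by (simp add: eval_fps_mult eval_fps_diff)
  qed
  have "ereal \<bar>x\<bar> < fps_conv_radius p" "ereal \<bar>x\<bar> < fps_conv_radius h"
    using x less_le_trans[OF _ p, of "ereal \<bar>x\<bar>"] less_le_trans[OF _ h, of "ereal \<bar>x\<bar>"]
    by (simp_all add: one_ereal_def)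
  then have "((\<lambda>y. pi / 2 * eval_fps p y) has_real_derivative
      pi / 2 * eval_fps (fps_const (a * (1 - a)) * h) x) (at x)"
    unfolding hypergeo_ode_fps[of a, folded h_def p_def, symmetric]
    by (intro DERIV_cmult has_field_derivative_eval_fps) simp
  moreover have "pi / 2 * eval_fps (fps_const (a * (1 - a)) * h) x
      = (real r - 1) / (real r)\<^sup>2 * K r x"
    using \<open>ereal \<bar>x\<bar> < fps_conv_radius h\<close> r
    by (subst eval_fps_mult) (auto simp: K a_def power2_eq_square field_simps)
  \<comment> \<open>This agreement on the open unit ball suffices to carry the derivative over at
    the interior point \<open>x\<close>.\<close>
  moreover have "pi / 2 * eval_fps p y = y * (1 - y) * deriv (K r) y" if "y \<in> ball 0 1" for y
    using that by (simp add: eval_p deriv)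
  ultimately show "((\<lambda>x. x * (1 - x) * deriv (K r) x) has_real_derivative
           (real r - 1) / (real r)\<^sup>2 * K r x) (at x)"
    using x by (auto intro: has_field_derivative_transform_within_open[where S = "ball 0 1"])
qed

lemma K_0: "K r 0 = pi / 2"
  by (simp add: K_eq_eval_fps eval_fps_at_0)

text \<open>All terms of the series are nonnegative and the constant term is 1.\<close>

lemma K_pos:
  assumes r: "r \<ge> 1" and x: "0 \<le> x" "x < 1"
  shows "K r x > 0"
proof -
  define h :: "real fps" where "h = fps_hypergeo [1 / real r, 1 - 1 / real r] [1] 1"
  have a: "0 \<le> 1 / real r" "1 / real r \<le> 1" using r by auto
  have "fps_conv_radius h \<ge> 1" unfolding h_def by (rule hypergeo_conv_radius[OF a])
  then have "summable (\<lambda>n. fps_nth h n * x ^ n)"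
    using x less_le_trans[of "ereal (norm x)" 1 "fps_conv_radius h"]
    by (intro summable_fps) (simp_all add: one_ereal_def)
  then have "eval_fps h x > 0"
    unfolding eval_fps_def using hypergeo_coeff_bounds[OF a] x
    by (intro suminf_pos2[where i = 0]) (simp_all add: h_def del: fps_hypergeo_nth)
  then show ?thesis by (simp add: K_eq_eval_fps h_def)
qed

section \<open>Transformation formulas from a common differential equation\<close>

text \<open>
  Here \<open>R = M\<^sup>2\<close> and \<open>\<sigma> = q M'/M\<close>, both rational even when the multiplier \<open>M\<close> is a square root.
  In terms of \<open>\<sigma>\<close>, the condition that \<open>M K(\<beta>)\<close> solves the same equation as \<open>K(\<alpha>)\<close> is a Riccati equation.
\<close>
lemma K_transformation:
  fixes \<alpha> \<beta> R q \<sigma> :: "real \<Rightarrow> real" and N :: real and r :: nat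
  defines "c \<equiv> (real r - 1) / (real r)\<^sup>2"
  assumes r: "r \<ge> 1" and N: "N > 0"
    and ab: "\<And>t. t > 0 \<Longrightarrow> 0 < \<alpha> t \<and> \<alpha> t < 1 \<and> 0 < \<beta> t \<and> \<beta> t < 1"
    and R: "\<And>t. t > 0 \<Longrightarrow> R t > 0"
    and q: "\<And>t. t > 0 \<Longrightarrow> q t \<noteq> 0"
    and d\<alpha>: "\<And>t. t > 0 \<Longrightarrow> (\<alpha> has_real_derivative \<alpha> t * (1 - \<alpha> t) / q t) (at t)"
    and d\<beta>: "\<And>t. t > 0 \<Longrightarrow> (\<beta> has_real_derivative \<beta> t * (1 - \<beta> t) / (N * R t * q t)) (at t)"
    and dR: "\<And>t. t > 0 \<Longrightarrow> (R has_real_derivative 2 * R t * \<sigma> t / q t) (at t)"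
    and d\<sigma>: "\<And>t. t > 0 \<Longrightarrow> (\<sigma> has_real_derivative
          (c * (\<alpha> t * (1 - \<alpha> t) - \<beta> t * (1 - \<beta> t) / (N * R t)\<^sup>2) - (\<sigma> t)\<^sup>2) / q t) (at t)"
    and cont: "isCont \<alpha> 0" "isCont \<beta> 0" "isCont R 0" "isCont \<sigma> 0"
    and at_0: "\<alpha> 0 = 0" "\<beta> 0 = 0" "R 0 = 1 / N\<^sup>2" "\<sigma> 0 = 0"
    and t: "t > 0"
  shows "K r (\<alpha> t) = N * sqrt (R t) * K r (\<beta> t)"
proof -
  \<comment> \<open>\<open>P\<close> vanishes at 0 and has derivative c K on the unit interval. By
    the chain rule and the given derivative of \<alpha>, \<open>P (\<alpha> t)\<close> is q
    F'.\<close>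
  define P where "P x = x * (1 - x) * deriv (K r) x" for x
  define M where "M t = sqrt (R t)" for t
  define F where "F t = K r (\<alpha> t)" for t
  define u where "u t = K r (\<beta> t)" for t
  \<comment> \<open>Likewise \<open>Z\<close> is q G' for G = M u, written out so that it can be
    differentiated from the given derivatives alone. Hence \<open>W\<close> is q times the Wronskian
    of F and G.\<close>
  define Z where "Z t = M t * \<sigma> t * u t + P (\<beta> t) / (N * M t)" for t
  define W where "W t = F t * Z t - M t * u t * P (\<alpha> t)" for t
  have M: "M t > 0" "R t = (M t)\<^sup>2" if "t > 0" for t using R[OF that] by (auto simp: M_def)
  have dP: "(P has_real_derivative c * K r x) (at x)" if "\<bar>x\<bar> < 1" for x
    unfolding P_def c_def by (rule K_ode[OF r that])
  have dM: "(M has_real_derivative M t * \<sigma> t / q t) (at t)" if "t > 0" for t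
  proof -
    have "(M has_real_derivative 2 * R t * \<sigma> t / q t * (inverse (sqrt (R t)) / 2)) (at t)"
      unfolding M_def by (rule DERIV_cong[OF DERIV_chain2[OF DERIV_real_sqrt[OF R] dR]]) (use that in auto)
    then show ?thesis
      using M[OF that] unfolding M_def[symmetric] by (simp add: field_simps power2_eq_square)
  qed
  have dF: "(F has_real_derivative P (\<alpha> t) / q t) (at t)" if "t > 0" for t
    unfolding F_def
    apply (rule DERIV_cong)
     apply (rule DERIV_chain2[OF K_has_derivative[OF r] d\<alpha>[OF that]])
    using ab[OF that] by (auto simp: P_def)
  have du: "(u has_real_derivative P (\<beta> t) / (N * (M t)\<^sup>2 * q t)) (at t)" if "t > 0" for t
    unfolding u_def
    apply (rule DERIV_cong)
     apply (rule DERIV_chain2[OF K_has_derivative[OF r] d\<beta>[OF that]])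
    using ab[OF that] by (auto simp: P_def M[OF that])
  have dPa: "((\<lambda>t. P (\<alpha> t)) has_real_derivative c * F t * (\<alpha> t * (1 - \<alpha> t) / q t)) (at t)"
    if "t > 0" for t
    unfolding F_def apply (rule DERIV_chain2[OF dP d\<alpha>[OF that]]) using ab[OF that] by auto
  have dPb: "((\<lambda>t. P (\<beta> t)) has_real_derivative
      c * u t * (\<beta> t * (1 - \<beta> t) / (N * (M t)\<^sup>2 * q t))) (at t)" if "t > 0" for t
    unfolding u_def M(2)[OF that, symmetric]
    apply (rule DERIV_chain2[OF dP d\<beta>[OF that]]) using ab[OF that] by auto
  \<comment> \<open>The \<sigma>^2 terms and those in \<beta>(1 - \<beta>) cancel by the Riccati
    equation \<open>d\<sigma>\<close>, those in P(\<beta>) by the product and quotient rules. What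
    remains is (q G')' = c \<alpha>(1 - \<alpha>) G / q, the equation that \<open>dPa\<close> states
    for F.\<close>
  have dZ: "(Z has_real_derivative c * u t * M t * (\<alpha> t * (1 - \<alpha> t)) / q t) (at t)"
    if "t > 0" for t
    unfolding Z_def
    apply (rule DERIV_cong[OF DERIV_add[OF DERIV_mult[OF DERIV_mult[OF dM d\<sigma>] du]
            DERIV_divide[OF dPb DERIV_cmult[OF dM]]]])
    using M[OF that] q[OF that] N that by (simp_all add: field_simps power2_eq_square)
  have dG: "((\<lambda>t. M t * u t) has_real_derivative Z t / q t) (at t)" if "t > 0" for t
    apply (rule derivative_eq_intros dM du that refl)+
    using M[OF that] q[OF that] N unfolding Z_def by (simp add: field_simps power2_eq_square)
  have dW: "(W has_real_derivative 0) (at t)" if "t > 0" for t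
    unfolding W_def
    apply (rule DERIV_cong[OF DERIV_diff[OF DERIV_mult[OF dF dZ] DERIV_mult[OF dG dPa]]])
    using q[OF that] that by (simp_all add: field_simps)
  have contP: "isCont P 0" "isCont (K r) 0"
    using dP[of 0] K_has_derivative[OF r, of 0] by (auto intro: DERIV_isCont)
  have lim: "(\<alpha> \<longlongrightarrow> 0) (at_right 0)" "(\<beta> \<longlongrightarrow> 0) (at_right 0)" "(\<sigma> \<longlongrightarrow> 0) (at_right 0)"
     "(R \<longlongrightarrow> 1 / N\<^sup>2) (at_right 0)"
    using cont at_0 unfolding isCont_def by (auto intro: tendsto_within_subset)
  have limP: "((\<lambda>t. P (\<alpha> t)) \<longlongrightarrow> 0) (at_right 0)" "((\<lambda>t. P (\<beta> t)) \<longlongrightarrow> 0) (at_right 0)"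
    using isCont_tendsto_compose[OF contP(1) lim(1)] isCont_tendsto_compose[OF contP(1) lim(2)]
    by (simp_all add: P_def)
  have limF: "(F \<longlongrightarrow> pi / 2) (at_right 0)" "(u \<longlongrightarrow> pi / 2) (at_right 0)"
    using isCont_tendsto_compose[OF contP(2) lim(1)] isCont_tendsto_compose[OF contP(2) lim(2)]
    unfolding F_def u_def by (simp_all add: K_0)
  have limM: "(M \<longlongrightarrow> 1 / N) (at_right 0)"
    using tendsto_real_sqrt[OF lim(4)] N unfolding M_def by (simp add: real_sqrt_divide)
  \<comment> \<open>Every summand of \<open>W\<close> contains \<sigma>, P(\<alpha>) or P(\<beta>),
    each of which tends to 0. The limit is left unsimplified to match the limit rules.\<close>
  have "(W \<longlongrightarrow> pi/2 * (1 / N * 0 * (pi / 2) + 0 / (N * (1 / N))) - 1 / N * (pi / 2) * 0) (at_right 0)"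
    unfolding W_def Z_def by (intro tendsto_intros limP limF limM lim) (use N in auto)
  then have limW: "(W \<longlongrightarrow> 0) (at_right 0)" by simp
  \<comment> \<open>Derivatives are available only for t > 0, so a constant is identified through
    the right-hand limit at 0. This serves first for \<open>W\<close>, then for G/F.\<close>
  have const: "g t = L" if d: "\<And>t. t > 0 \<Longrightarrow> (g has_real_derivative 0) (at t)"
    and l: "(g \<longlongrightarrow> L) (at_right 0)" and t: "t > 0" for g :: "real \<Rightarrow> real" and L t
  proof -
    obtain C where C: "\<And>x. x \<in> {0<..} \<Longrightarrow> g x = C"
      using has_field_derivative_zero_constant[of "{0<..}" g] d
      by (auto intro: has_field_derivative_at_within)
    have "((\<lambda>_. C) \<longlongrightarrow> L) (at_right (0::real))"
      using C by (intro Lim_transform_eventually[OF l] eventually_mono[OF eventually_at_right_less])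
        simp
    then show ?thesis using C t by (auto simp: tendsto_const_iff)
  qed
  have W0: "F t * Z t = M t * u t * P (\<alpha> t)" if "t > 0" for t
    using const[OF dW limW that] by (simp add: W_def)
  have Fpos: "F t > 0" if "t > 0" for t
    unfolding F_def using K_pos[OF r] ab[OF that] by auto
  have dQ: "((\<lambda>t. M t * u t / F t) has_real_derivative 0) (at t)" if "t > 0" for t
  proof -
    have "((\<lambda>t. M t * u t / F t) has_real_derivative
       (Z t / q t * F t - M t * u t * (P (\<alpha> t) / q t)) / (F t * F t)) (at t)"
      using Fpos[OF that] by (intro DERIV_divide dG dF that) auto
    moreover have "Z t / q t * F t - M t * u t * (P (\<alpha> t) / q t) = 0"
      using W0[OF that] by (simp add: field_simps)
    ultimately show ?thesis by (simp only: div_0)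
  qed
  \<comment> \<open>\<alpha> and \<beta> both vanish at 0, where K is pi/2; only the limit 1/N of M
    survives.\<close>
  have "((\<lambda>t. M t * u t / F t) \<longlongrightarrow> 1 / N * (pi / 2) / (pi / 2)) (at_right 0)"
    by (intro tendsto_intros limF limM) auto
  from const[OF dQ this t] have "M t * u t / F t = 1 / N" by simp
  then show ?thesis using Fpos[OF t] N by (simp add: field_simps F_def M_def u_def)
qed

text \<open>The involution t -> d/t serves twice: it turns positivity of \<beta> and \<alpha> into
  \<alpha> < 1 and \<beta> < 1, and it derives the degree relation from the identity itself.\<close>

lemma modular_identity_primitive:
  fixes \<alpha> \<beta> M R q \<sigma> :: "real \<Rightarrow> real" and N d :: real and r :: nat
  assumes r: "r \<ge> 1" and N: "N > 0"
    and pos: "\<And>t. t > 0 \<Longrightarrow> \<alpha> t > 0" "\<And>t. t > 0 \<Longrightarrow> \<beta> t > 0" "\<And>t. t > 0 \<Longrightarrow> M t > 0"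
      "\<And>t. t > 0 \<Longrightarrow> q t > 0"
    and R: "\<And>t. t > 0 \<Longrightarrow> R t = (M t)\<^sup>2"
    and d: "d > 0"
    and inv: "\<And>t. t > 0 \<Longrightarrow> 1 - \<alpha> t = \<beta> (d / t)"
      "\<And>t. t > 0 \<Longrightarrow> N\<^sup>2 * R t * R (d / t) = 1"
    and deriv: "\<And>t. t > 0 \<Longrightarrow> (\<alpha> has_real_derivative \<alpha> t * (1 - \<alpha> t) / q t) (at t)"
      "\<And>t. t > 0 \<Longrightarrow> (\<beta> has_real_derivative \<beta> t * (1 - \<beta> t) / (N * R t * q t)) (at t)"
      "\<And>t. t > 0 \<Longrightarrow> (R has_real_derivative 2 * R t * \<sigma> t / q t) (at t)"
      "\<And>t. t > 0 \<Longrightarrow> (\<sigma> has_real_derivative ((real r - 1) / (real r)\<^sup>2 *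
          (\<alpha> t * (1 - \<alpha> t) - \<beta> t * (1 - \<beta> t) / (N * R t)\<^sup>2) - (\<sigma> t)\<^sup>2) / q t) (at t)"
    and cont: "isCont \<alpha> 0" "isCont \<beta> 0" "isCont R 0" "isCont \<sigma> 0"
    and at_0: "\<alpha> 0 = 0" "\<beta> 0 = 0" "R 0 = 1 / N\<^sup>2" "\<sigma> 0 = 0"
  shows "modular_identity r N \<alpha> M \<beta>"
  unfolding modular_identity_def
proof (intro allI impI)
  fix t :: real assume t: "t > 0"
  have Rpos: "R t > 0" and M: "sqrt (R t) = M t" if "t > 0" for t
    using R[OF that] pos(3)[OF that] by simp_all
  \<comment> \<open>The map t -> d/t is its own inverse.\<close>
  have \<beta>: "\<beta> t = 1 - \<alpha> (d / t)" if "t > 0" for t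
    using inv(1)[of "d / t"] d that by simp
  have ab: "0 < \<alpha> t \<and> \<alpha> t < 1 \<and> 0 < \<beta> t \<and> \<beta> t < 1" if "t > 0" for t
    using pos(1,2)[of t] pos(1,2)[of "d / t"] inv(1)[OF that] \<beta>[OF that] d that by auto
  have id: "K r (\<alpha> t) = N * M t * K r (\<beta> t)" if "t > 0" for t
    unfolding M[OF that, symmetric] using pos(4)
    by (intro K_transformation[where \<alpha> = \<alpha> and \<beta> = \<beta> and R = R and q = q and \<sigma> = \<sigma>]
          r N ab Rpos deriv cont at_0 that) (force+)
  have "N * M t * M (d / t) = sqrt (N\<^sup>2 * R t * R (d / t))"
    using M[OF t] M[of "d / t"] N d t by (simp add: real_sqrt_mult)
  then have "N * M t * M (d / t) = 1" using inv(2)[OF t] by simp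
  \<comment> \<open>This is the identity at d/t, where \<alpha> and \<beta> take the values 1 -
    \<beta>(t) and 1 - \<alpha>(t).\<close>
  moreover have "K' r (\<beta> t) = N * M (d / t) * K' r (\<alpha> t)"
    using id[of "d / t"] d t inv(1)[OF t] \<beta>[OF t] by (simp add: K'_def)
  ultimately have "K' r (\<alpha> t) = M t * K' r (\<beta> t)" by (simp add: mult_ac)
  then have "degree_relation r N (\<alpha> t) (\<beta> t)"
    unfolding degree_relation_def id[OF t] using N pos(3)[OF t] by simp
  then show "0 < \<alpha> t \<and> \<alpha> t < 1 \<and> 0 < \<beta> t \<and> \<beta> t < 1 \<and>
      K r (\<alpha> t) = N * M t * K r (\<beta> t) \<and> degree_relation r N (\<alpha> t) (\<beta> t)"
    using ab[OF t] id[OF t] by auto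
qed

section \<open>The primitive identities of degree 2, 3 and 5\<close>

text \<open>This is Landen's transformation: with s = sqrt(1 - \<alpha>) = 4/(t + 4), the root of
  \<beta> is l = (1 - s)/(1 + s), and 2M = 1 + l.\<close>

lemma modular_identity_2_2:
  "modular_identity 2 2
     (\<lambda>t. t * (t + 8) / (t + 4) ^ 2)
     (\<lambda>t. (t + 4) / (t + 8))
     (\<lambda>t. t ^ 2 / (t + 8) ^ 2)"
  (is "modular_identity _ _ ?\<alpha> ?M ?\<beta>")
proof -
  let ?R = "\<lambda>t::real. ((t + 4) / (t + 8)) ^ 2"
  \<comment> \<open>Here and in the following proofs \<open>?q\<close> is \<alpha>(1 -
    \<alpha>)/\<alpha>' and \<open>?\<sigma>\<close> is q R'/(2R), both after cancellation.\<close>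
  let ?q = "\<lambda>t::real. t * (t + 8) / (2 * (t + 4))"
  let ?\<sigma> = "\<lambda>t::real. 2 * t / (t + 4) ^ 2"
  show ?thesis
  \<comment> \<open>32 = 4 * 8, since t -> d/t has to exchange the zero -4 and the pole -8 of the
    multiplier. The later values of \<open>d\<close> arise in the same way.\<close>
  proof (rule modular_identity_primitive[where d = 32 and R = ?R and q = ?q and \<sigma> = ?\<sigma>])
    fix t :: real assume t: "t > 0"
    have "t > 0" "t + 8 > 0" "t + 4 > 0"
      using t by (auto intro!: add_pos_pos)
    note nz = this[THEN less_imp_neq, THEN not_sym]
    show "?\<alpha> t > 0" "?\<beta> t > 0" "?q t > 0" and M: "?M t > 0"
      by (intro real_sqrt_gt_zero divide_pos_pos mult_pos_pos add_pos_pos zero_less_power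
          zero_less_numeral t)+
    show "?R t = (?M t)\<^sup>2"
      using M by (simp add: less_imp_le)
    \<comment> \<open>The linear factors at 32/t are brought to single fractions, so that the claims
      below become polynomial identities.\<close>
    have d: "(32 / t) + 8 = 8 * (t + 4) / t"
      "(32 / t) + 4 = 4 * (t + 8) / t"
      using t by (simp_all add: field_simps power2_eq_square)
    show "1 - ?\<alpha> t = ?\<beta> (32 / t)" "2\<^sup>2 * ?R t * ?R (32 / t) = 1"
      unfolding d by (simp add: divide_simps nz del: distrib_left_numeral;
          (algebra | simp add: algebra_simps power2_eq_square power3_eq_cube))+
    show "(?\<alpha> has_real_derivative ?\<alpha> t * (1 - ?\<alpha> t) / ?q t) (at t)"
      "(?\<beta> has_real_derivative ?\<beta> t * (1 - ?\<beta> t) / (2 * ?R t * ?q t)) (at t)"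
      "(?R has_real_derivative 2 * ?R t * ?\<sigma> t / ?q t) (at t)"
      "(?\<sigma> has_real_derivative ((real 2 - 1) / (real 2)\<^sup>2 *
          (?\<alpha> t * (1 - ?\<alpha> t) - ?\<beta> t * (1 - ?\<beta> t) / (2 * ?R t)\<^sup>2) - (?\<sigma> t)\<^sup>2) / ?q t) (at t)"
      by (rule DERIV_cong,
          (rule derivative_intros no_zero_divisors power_not_zero zero_neq_numeral[THEN not_sym] nz)+,
          (simp add: divide_simps nz del: distrib_left_numeral; algebra))+
  qed (auto intro!: continuous_intros simp: power2_eq_square)
qed

text \<open>With p = t/(t + 6) this is the classical parametrization \<alpha> = p((2 + p)/(1 +
  2p))^3, \<beta> = p^3(2 + p)/(1 + 2p), 3M = 1 + 2p.\<close>

lemma modular_identity_2_3: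
  "modular_identity 2 3
     (\<lambda>t. t * (t + 4) ^ 3 / ((t + 2) ^ 3 * (t + 6)))
     (\<lambda>t. (t + 2) / (t + 6))
     (\<lambda>t. t ^ 3 * (t + 4) / ((t + 2) * (t + 6) ^ 3))"
  (is "modular_identity _ _ ?\<alpha> ?M ?\<beta>")
proof -
  let ?R = "\<lambda>t::real. ((t + 2) / (t + 6)) ^ 2"
  let ?q = "\<lambda>t::real. t * (t + 3) * (t + 4) / (3 * (t + 2) ^ 2)"
  let ?\<sigma> = "\<lambda>t::real. 4 * t * (t + 3) * (t + 4) / (3 * (t + 2) ^ 3 * (t + 6))"
  show ?thesis
  proof (rule modular_identity_primitive[where d = 12 and R = ?R and q = ?q and \<sigma> = ?\<sigma>])
    fix t :: real assume t: "t > 0"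
    \<comment> \<open>The factor t + 3 comes from 1 - \<alpha> = 16(t + 3)/((t + 2)^3(t + 6)) and
      hence stands in \<open>?q\<close>.\<close>
    have "t > 0" "t + 4 > 0" "t + 2 > 0" "t + 6 > 0" "t + 3 > 0"
      using t by (auto intro!: add_pos_pos)
    note nz = this[THEN less_imp_neq, THEN not_sym]
    show "?\<alpha> t > 0" "?\<beta> t > 0" "?q t > 0" and M: "?M t > 0"
      by (intro real_sqrt_gt_zero divide_pos_pos mult_pos_pos add_pos_pos zero_less_power
          zero_less_numeral t)+
    show "?R t = (?M t)\<^sup>2"
      using M by (simp add: less_imp_le)
    have d: "(12 / t) + 4 = 4 * (t + 3) / t"
      "(12 / t) + 2 = 2 * (t + 6) / t"
      "(12 / t) + 6 = 6 * (t + 2) / t"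
      using t by (simp_all add: field_simps power2_eq_square)
    show "1 - ?\<alpha> t = ?\<beta> (12 / t)" "3\<^sup>2 * ?R t * ?R (12 / t) = 1"
      unfolding d by (simp add: divide_simps nz del: distrib_left_numeral;
          (algebra | simp add: algebra_simps power2_eq_square power3_eq_cube))+
    show "(?\<alpha> has_real_derivative ?\<alpha> t * (1 - ?\<alpha> t) / ?q t) (at t)"
      "(?\<beta> has_real_derivative ?\<beta> t * (1 - ?\<beta> t) / (3 * ?R t * ?q t)) (at t)"
      "(?R has_real_derivative 2 * ?R t * ?\<sigma> t / ?q t) (at t)"
      "(?\<sigma> has_real_derivative ((real 2 - 1) / (real 2)\<^sup>2 *
          (?\<alpha> t * (1 - ?\<alpha> t) - ?\<beta> t * (1 - ?\<beta> t) / (3 * ?R t)\<^sup>2) - (?\<sigma> t)\<^sup>2) / ?q t) (at t)"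
      by (rule DERIV_cong,
          (rule derivative_intros no_zero_divisors power_not_zero zero_neq_numeral[THEN not_sym] nz)+,
          (simp add: divide_simps nz del: distrib_left_numeral; algebra))+
  qed (auto intro!: continuous_intros simp: power2_eq_square)
qed

text \<open>With p = t/(t + 12): \<alpha> = p(3 + p)^2/(2(1 + p)^3), \<beta> = p^2(3 + p)/4, 2M = 1
  + p.\<close>

lemma modular_identity_3_2:
  "modular_identity 3 2
     (\<lambda>t. t * (t + 9) ^ 2 / (t + 6) ^ 3)
     (\<lambda>t. (t + 6) / (t + 12))
     (\<lambda>t. t ^ 2 * (t + 9) / (t + 12) ^ 3)"
  (is "modular_identity _ _ ?\<alpha> ?M ?\<beta>")
proof -
  let ?R = "\<lambda>t::real. ((t + 6) / (t + 12)) ^ 2"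
  let ?q = "\<lambda>t::real. t * (t + 8) * (t + 9) / (2 * (t + 6) ^ 2)"
  let ?\<sigma> = "\<lambda>t::real. 3 * t * (t + 8) * (t + 9) / ((t + 6) ^ 3 * (t + 12))"
  show ?thesis
  proof (rule modular_identity_primitive[where d = 72 and R = ?R and q = ?q and \<sigma> = ?\<sigma>])
    fix t :: real assume t: "t > 0"
    have "t > 0" "t + 9 > 0" "t + 6 > 0" "t + 12 > 0" "t + 8 > 0"
      using t by (auto intro!: add_pos_pos)
    note nz = this[THEN less_imp_neq, THEN not_sym]
    show "?\<alpha> t > 0" "?\<beta> t > 0" "?q t > 0" and M: "?M t > 0"
      by (intro real_sqrt_gt_zero divide_pos_pos mult_pos_pos add_pos_pos zero_less_power
          zero_less_numeral t)+
    show "?R t = (?M t)\<^sup>2"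
      using M by (simp add: less_imp_le)
    have d: "(72 / t) + 9 = 9 * (t + 8) / t"
      "(72 / t) + 12 = 12 * (t + 6) / t"
      "(72 / t) + 6 = 6 * (t + 12) / t"
      using t by (simp_all add: field_simps power2_eq_square)
    show "1 - ?\<alpha> t = ?\<beta> (72 / t)" "2\<^sup>2 * ?R t * ?R (72 / t) = 1"
      unfolding d by (simp add: divide_simps nz del: distrib_left_numeral;
          (algebra | simp add: algebra_simps power2_eq_square power3_eq_cube))+
    show "(?\<alpha> has_real_derivative ?\<alpha> t * (1 - ?\<alpha> t) / ?q t) (at t)"
      "(?\<beta> has_real_derivative ?\<beta> t * (1 - ?\<beta> t) / (2 * ?R t * ?q t)) (at t)"
      "(?R has_real_derivative 2 * ?R t * ?\<sigma> t / ?q t) (at t)"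
      "(?\<sigma> has_real_derivative ((real 3 - 1) / (real 3)\<^sup>2 *
          (?\<alpha> t * (1 - ?\<alpha> t) - ?\<beta> t * (1 - ?\<beta> t) / (2 * ?R t)\<^sup>2) - (?\<sigma> t)\<^sup>2) / ?q t) (at t)"
      by (rule DERIV_cong,
          (rule derivative_intros no_zero_divisors power_not_zero zero_neq_numeral[THEN not_sym] nz)+,
          (simp add: divide_simps nz del: distrib_left_numeral; algebra))+
  qed (auto intro!: continuous_intros simp: power2_eq_square)
qed

text \<open>The cubic analogue of Landen's transformation: with s = 3/(t + 3) the cube root of 1 -
  \<alpha>, that of \<beta> is l = (1 - s)/(1 + 2s), and 3M = 1 + 2l.\<close>

lemma modular_identity_3_3:
  "modular_identity 3 3
     (\<lambda>t. t * (t ^ 2 + 9 * t + 27) / (t + 3) ^ 3)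
     (\<lambda>t. (t + 3) / (t + 9))
     (\<lambda>t. t ^ 3 / (t + 9) ^ 3)"
  (is "modular_identity _ _ ?\<alpha> ?M ?\<beta>")
proof -
  let ?R = "\<lambda>t::real. ((t + 3) / (t + 9)) ^ 2"
  let ?q = "\<lambda>t::real. t * (t ^ 2 + 9 * t + 27) / (3 * (t + 3) ^ 2)"
  let ?\<sigma> = "\<lambda>t::real. 2 * t * (t ^ 2 + 9 * t + 27) / ((t + 3) ^ 3 * (t + 9))"
  show ?thesis
  proof (rule modular_identity_primitive[where d = 27 and R = ?R and q = ?q and \<sigma> = ?\<sigma>])
    fix t :: real assume t: "t > 0"
    have "t > 0" "t ^ 2 + 9 * t + 27 > 0" "t + 3 > 0" "t + 9 > 0"
      using t by (auto intro!: add_pos_pos)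
    note nz = this[THEN less_imp_neq, THEN not_sym]
    show "?\<alpha> t > 0" "?\<beta> t > 0" "?q t > 0" and M: "?M t > 0"
      by (intro real_sqrt_gt_zero divide_pos_pos mult_pos_pos add_pos_pos zero_less_power
          zero_less_numeral t)+
    show "?R t = (?M t)\<^sup>2"
      using M by (simp add: less_imp_le)
    have d: "(27 / t) + 9 = 9 * (t + 3) / t"
      "(27 / t) + 3 = 3 * (t + 9) / t"
      using t by (simp_all add: field_simps power2_eq_square)
    show "1 - ?\<alpha> t = ?\<beta> (27 / t)" "3\<^sup>2 * ?R t * ?R (27 / t) = 1"
      unfolding d by (simp add: divide_simps nz del: distrib_left_numeral;
          (algebra | simp add: algebra_simps power2_eq_square power3_eq_cube))+
    show "(?\<alpha> has_real_derivative ?\<alpha> t * (1 - ?\<alpha> t) / ?q t) (at t)"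
      "(?\<beta> has_real_derivative ?\<beta> t * (1 - ?\<beta> t) / (3 * ?R t * ?q t)) (at t)"
      "(?R has_real_derivative 2 * ?R t * ?\<sigma> t / ?q t) (at t)"
      "(?\<sigma> has_real_derivative ((real 3 - 1) / (real 3)\<^sup>2 *
          (?\<alpha> t * (1 - ?\<alpha> t) - ?\<beta> t * (1 - ?\<beta> t) / (3 * ?R t)\<^sup>2) - (?\<sigma> t)\<^sup>2) / ?q t) (at t)"
      by (rule DERIV_cong,
          (rule derivative_intros no_zero_divisors power_not_zero zero_neq_numeral[THEN not_sym] nz)+,
          (simp add: divide_simps nz del: distrib_left_numeral; algebra))+
  qed (auto intro!: continuous_intros simp: power2_eq_square)
qed

text \<open>With s = sqrt(1 - \<alpha>) = 8/(t + 8), the root of \<beta> is l = (1 - s)/(1 + 3s),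
  and 4M^2 = 1 + 3l. From here on M is a square root and \<open>?R\<close> its radicand.\<close>

lemma modular_identity_4_2:
  "modular_identity 4 2
     (\<lambda>t. t * (t + 16) / (t + 8) ^ 2)
     (\<lambda>t. sqrt ((t + 8) / (t + 32)))
     (\<lambda>t. t ^ 2 / (t + 32) ^ 2)"
  (is "modular_identity _ _ ?\<alpha> ?M ?\<beta>")
proof -
  let ?R = "\<lambda>t::real. (t + 8) / (t + 32)"
  let ?q = "\<lambda>t::real. t * (t + 16) / (2 * (t + 8))"
  let ?\<sigma> = "\<lambda>t::real. 6 * t * (t + 16) / ((t + 8) ^ 2 * (t + 32))"
  show ?thesis
  proof (rule modular_identity_primitive[where d = 256 and R = ?R and q = ?q and \<sigma> = ?\<sigma>])
    fix t :: real assume t: "t > 0"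
    have "t > 0" "t + 16 > 0" "t + 8 > 0" "t + 32 > 0"
      using t by (auto intro!: add_pos_pos)
    note nz = this[THEN less_imp_neq, THEN not_sym]
    show "?\<alpha> t > 0" "?\<beta> t > 0" "?q t > 0" and M: "?M t > 0"
      by (intro real_sqrt_gt_zero divide_pos_pos mult_pos_pos add_pos_pos zero_less_power
          zero_less_numeral t)+
    show "?R t = (?M t)\<^sup>2"
      using M by (simp add: less_imp_le)
    have d: "(256 / t) + 32 = 32 * (t + 8) / t"
      "(256 / t) + 8 = 8 * (t + 32) / t"
      using t by (simp_all add: field_simps power2_eq_square)
    show "1 - ?\<alpha> t = ?\<beta> (256 / t)" "2\<^sup>2 * ?R t * ?R (256 / t) = 1"
      unfolding d by (simp add: divide_simps nz del: distrib_left_numeral;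
          (algebra | simp add: algebra_simps power2_eq_square power3_eq_cube))+
    show "(?\<alpha> has_real_derivative ?\<alpha> t * (1 - ?\<alpha> t) / ?q t) (at t)"
      "(?\<beta> has_real_derivative ?\<beta> t * (1 - ?\<beta> t) / (2 * ?R t * ?q t)) (at t)"
      "(?R has_real_derivative 2 * ?R t * ?\<sigma> t / ?q t) (at t)"
      "(?\<sigma> has_real_derivative ((real 4 - 1) / (real 4)\<^sup>2 *
          (?\<alpha> t * (1 - ?\<alpha> t) - ?\<beta> t * (1 - ?\<beta> t) / (2 * ?R t)\<^sup>2) - (?\<sigma> t)\<^sup>2) / ?q t) (at t)"
      by (rule DERIV_cong,
          (rule derivative_intros no_zero_divisors power_not_zero zero_neq_numeral[THEN not_sym] nz)+,
          (simp add: divide_simps nz del: distrib_left_numeral; algebra))+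
  qed (auto intro!: continuous_intros simp: power2_eq_square)
qed

lemma modular_identity_4_3:
  "modular_identity 4 3
     (\<lambda>t. t * (t + 8) ^ 3 / (t ^ 2 + 12 * t + 24) ^ 2)
     (\<lambda>t. sqrt ((t ^ 2 + 12 * t + 24) / (t ^ 2 + 36 * t + 216)))
     (\<lambda>t. t ^ 3 * (t + 8) / (t ^ 2 + 36 * t + 216) ^ 2)"
  (is "modular_identity _ _ ?\<alpha> ?M ?\<beta>")
proof -
  let ?R = "\<lambda>t::real. (t ^ 2 + 12 * t + 24) / (t ^ 2 + 36 * t + 216)"
  let ?q = "\<lambda>t::real. t * (t + 8) * (t + 9) / (3 * (t ^ 2 + 12 * t + 24))"
  \<comment> \<open>The quadratic t^2 + 16t + 72 comes from the numerator of R', which is 24 times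
    it.\<close>
  let ?\<sigma> = "\<lambda>t::real. 4 * t * (t + 8) * (t + 9) * (t ^ 2 + 16 * t + 72) / ((t ^ 2 + 12 * t + 24) ^ 2 * (t ^ 2 + 36 * t + 216))"
  show ?thesis
  \<comment> \<open>The involution now exchanges the two quadratics of R up to factors, and their
    constant terms multiply to 24 * 216 = 72^2.\<close>
  proof (rule modular_identity_primitive[where d = 72 and R = ?R and q = ?q and \<sigma> = ?\<sigma>])
    fix t :: real assume t: "t > 0"
    have "t > 0" "t + 8 > 0" "t ^ 2 + 12 * t + 24 > 0" "t ^ 2 + 36 * t + 216 > 0" "t + 9 > 0" "t ^ 2 + 16 * t + 72 > 0"
      using t by (auto intro!: add_pos_pos)
    note nz = this[THEN less_imp_neq, THEN not_sym]
    show "?\<alpha> t > 0" "?\<beta> t > 0" "?q t > 0" and M: "?M t > 0"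
      by (intro real_sqrt_gt_zero divide_pos_pos mult_pos_pos add_pos_pos zero_less_power
          zero_less_numeral t)+
    show "?R t = (?M t)\<^sup>2"
      using M by (simp add: less_imp_le)
    have d: "(72 / t) + 8 = 8 * (t + 9) / t"
      "(72 / t) ^ 2 + 36 * (72 / t) + 216 = 216 * (t ^ 2 + 12 * t + 24) / t ^ 2"
      "(72 / t) ^ 2 + 12 * (72 / t) + 24 = 24 * (t ^ 2 + 36 * t + 216) / t ^ 2"
      using t by (simp_all add: field_simps power2_eq_square)
    show "1 - ?\<alpha> t = ?\<beta> (72 / t)" "3\<^sup>2 * ?R t * ?R (72 / t) = 1"
      unfolding d by (simp add: divide_simps nz del: distrib_left_numeral;
          (algebra | simp add: algebra_simps power2_eq_square power3_eq_cube))+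
    show "(?\<alpha> has_real_derivative ?\<alpha> t * (1 - ?\<alpha> t) / ?q t) (at t)"
      "(?\<beta> has_real_derivative ?\<beta> t * (1 - ?\<beta> t) / (3 * ?R t * ?q t)) (at t)"
      "(?R has_real_derivative 2 * ?R t * ?\<sigma> t / ?q t) (at t)"
      "(?\<sigma> has_real_derivative ((real 4 - 1) / (real 4)\<^sup>2 *
          (?\<alpha> t * (1 - ?\<alpha> t) - ?\<beta> t * (1 - ?\<beta> t) / (3 * ?R t)\<^sup>2) - (?\<sigma> t)\<^sup>2) / ?q t) (at t)"
      by (rule DERIV_cong,
          (rule derivative_intros no_zero_divisors power_not_zero zero_neq_numeral[THEN not_sym] nz)+,
          (simp add: divide_simps nz del: distrib_left_numeral; algebra))+
  qed (auto intro!: continuous_intros simp: power2_eq_square)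
qed

lemma modular_identity_4_5:
  "modular_identity 4 5
     (\<lambda>t. t * (t + 4) ^ 5 / ((t ^ 2 + 6 * t + 4) ^ 2 * (t ^ 2 + 8 * t + 20)))
     (\<lambda>t. sqrt ((t ^ 2 + 6 * t + 4) / (t ^ 2 + 30 * t + 100)))
     (\<lambda>t. t ^ 5 * (t + 4) / ((t ^ 2 + 8 * t + 20) * (t ^ 2 + 30 * t + 100) ^ 2))"
  (is "modular_identity _ _ ?\<alpha> ?M ?\<beta>")
proof -
  let ?R = "\<lambda>t::real. (t ^ 2 + 6 * t + 4) / (t ^ 2 + 30 * t + 100)"
  let ?q = "\<lambda>t::real. t * (t + 4) * (t + 5) / (5 * (t ^ 2 + 6 * t + 4))"
  \<comment> \<open>The numerator of R' is 24(t^2 + 8t + 20). This quadratic is preserved by t ->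
    20/t up to a factor, in keeping with its place in the denominators of both \<alpha> and
    \<beta>.\<close>
  let ?\<sigma> = "\<lambda>t::real. 12 * t * (t + 4) * (t + 5) * (t ^ 2 + 8 * t + 20) / (5 * (t ^ 2 + 6 * t + 4) ^ 2 * (t ^ 2 + 30 * t + 100))"
  show ?thesis
  proof (rule modular_identity_primitive[where d = 20 and R = ?R and q = ?q and \<sigma> = ?\<sigma>])
    fix t :: real assume t: "t > 0"
    have "t > 0" "t + 4 > 0" "t ^ 2 + 6 * t + 4 > 0" "t ^ 2 + 8 * t + 20 > 0" "t ^ 2 + 30 * t + 100 > 0" "t + 5 > 0"
      using t by (auto intro!: add_pos_pos)
    note nz = this[THEN less_imp_neq, THEN not_sym]
    show "?\<alpha> t > 0" "?\<beta> t > 0" "?q t > 0" and M: "?M t > 0"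
      by (intro real_sqrt_gt_zero divide_pos_pos mult_pos_pos add_pos_pos zero_less_power
          zero_less_numeral t)+
    show "?R t = (?M t)\<^sup>2"
      using M by (simp add: less_imp_le)
    have d: "(20 / t) + 4 = 4 * (t + 5) / t"
      "(20 / t) ^ 2 + 8 * (20 / t) + 20 = 20 * (t ^ 2 + 8 * t + 20) / t ^ 2"
      "(20 / t) ^ 2 + 30 * (20 / t) + 100 = 100 * (t ^ 2 + 6 * t + 4) / t ^ 2"
      "(20 / t) ^ 2 + 6 * (20 / t) + 4 = 4 * (t ^ 2 + 30 * t + 100) / t ^ 2"
      using t by (simp_all add: field_simps power2_eq_square)
    show "1 - ?\<alpha> t = ?\<beta> (20 / t)" "5\<^sup>2 * ?R t * ?R (20 / t) = 1"
      unfolding d by (simp add: divide_simps nz del: distrib_left_numeral;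
          (algebra | simp add: algebra_simps power2_eq_square power3_eq_cube))+
    show "(?\<alpha> has_real_derivative ?\<alpha> t * (1 - ?\<alpha> t) / ?q t) (at t)"
      "(?\<beta> has_real_derivative ?\<beta> t * (1 - ?\<beta> t) / (5 * ?R t * ?q t)) (at t)"
      "(?R has_real_derivative 2 * ?R t * ?\<sigma> t / ?q t) (at t)"
      "(?\<sigma> has_real_derivative ((real 4 - 1) / (real 4)\<^sup>2 *
          (?\<alpha> t * (1 - ?\<alpha> t) - ?\<beta> t * (1 - ?\<beta> t) / (5 * ?R t)\<^sup>2) - (?\<sigma> t)\<^sup>2) / ?q t) (at t)"
      by (rule DERIV_cong,
          (rule derivative_intros no_zero_divisors power_not_zero zero_neq_numeral[THEN not_sym] nz)+,
          (simp add: divide_simps nz del: distrib_left_numeral; algebra))+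
  qed (auto intro!: continuous_intros simp: power2_eq_square)
qed

section \<open>Substitution, composition and division of identities\<close>

lemma modular_identity_compose:
  assumes "modular_identity r N A M B" "\<And>t. t > 0 \<Longrightarrow> g t > 0"
  shows "modular_identity r N (A \<circ> g) (M \<circ> g) (B \<circ> g)"
  using assms by (simp add: modular_identity_def)

text \<open>The middle argument \<open>B\<close>, equal to \<open>C\<close>, is eliminated; degrees
  and multipliers then multiply.\<close>

lemma modular_identity_trans:
  assumes "modular_identity r N1 A M1 B" "modular_identity r N2 C M2 D" "coincide B C"
    and N: "N = N1 * N2" and M: "\<And>t. t > 0 \<Longrightarrow> M t = M1 t * M2 t"
  shows "modular_identity r N A M D"
  unfolding modular_identity_def
proof (intro allI impI)
  fix t :: real assume t: "t > 0"
  note * = assms(1-3)[unfolded modular_identity_def coincide_def degree_relation_def,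
      rule_format, OF t]
  have "K r (A t) = N1 * M1 t * (N2 * M2 t * K r (D t))" using * by metis
  then have "K r (A t) = N * M t * K r (D t)" by (simp only: N M[OF t] mult_ac)
  moreover have "K' r (D t) / K r (D t) = N2 * (N1 * (K' r (A t) / K r (A t)))" using * by metis
  then have "degree_relation r N (A t) (D t)"
    by (simp only: degree_relation_def N mult_ac)
  ultimately show "0 < A t \<and> A t < 1 \<and> 0 < D t \<and> D t < 1 \<and>
      K r (A t) = N * M t * K r (D t) \<and> degree_relation r N (A t) (D t)"
    using * by blast
qed

text \<open>Two identities starting from the same argument are divided by each other, which yields
  fractional degrees. \<open>M\<close> is characterized by a product, so that square roots can be
  compared through their radicands.\<close>

lemma modular_identity_quotient:
  assumes "modular_identity r N1 A M1 B" "modular_identity r N2 C M2 D" "coincide A C"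
    and N: "N1 > 0" "N = N2 / N1"
    and M: "\<And>t. t > 0 \<Longrightarrow> M1 t > 0" "\<And>t. t > 0 \<Longrightarrow> M1 t * M t = M2 t"
  shows "modular_identity r N B M D"
  unfolding modular_identity_def
proof (intro allI impI)
  fix t :: real assume t: "t > 0"
  note * = assms(1-3)[unfolded modular_identity_def coincide_def degree_relation_def,
      rule_format, OF t]
  have "N1 * M1 t * K r (B t) = N2 * (M1 t * M t) * K r (D t)" using * M(2)[OF t] by metis
  then have "N1 * M1 t * K r (B t) = N1 * M1 t * (N * M t * K r (D t))"
    using N by simp
  then have "K r (B t) = N * M t * K r (D t)"
    using N(1) M(1)[OF t] by simp
  moreover have "K' r (D t) / K r (D t) = N2 * (K' r (A t) / K r (A t))"
    "K' r (B t) / K r (B t) = N1 * (K' r (A t) / K r (A t))" using * by metis+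
  then have "degree_relation r N (B t) (D t)"
    using N by (simp add: degree_relation_def)
  ultimately show "0 < B t \<and> B t < 1 \<and> 0 < D t \<and> D t < 1 \<and>
      K r (B t) = N * M t * K r (D t) \<and> degree_relation r N (B t) (D t)"
    using * by blast
qed

section \<open>Agreement of composite rational functions\<close>

text \<open>Here and in the next three statements the right argument of an identity meets the left
  argument of the same identity under another substitution: the middle link when it is
  iterated.\<close>

lemma coincide_2_4:
  "coincide
     ((\<lambda>t. t ^ 2 / (t + 8) ^ 2) \<circ> (\<lambda>t. t * (t + 4)))
     ((\<lambda>t. t * (t + 8) / (t + 4) ^ 2) \<circ> (\<lambda>t. t ^ 2 / (t + 2)))"
  unfolding coincide_def o_def
  \<comment> \<open>Each denominator is built from sums of nonnegative terms with a positive one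
    among them, hence nonzero; cross-multiplication leaves a polynomial identity.\<close>
  by (intro allI impI) (simp add: divide_simps add_nonneg_eq_0_iff less_imp_le del: distrib_left_numeral, algebra)

lemma coincide_3_4:
  "coincide
     ((\<lambda>t. t ^ 2 * (t + 9) / (t + 12) ^ 3) \<circ> (\<lambda>t. t * (t + 6)))
     ((\<lambda>t. t * (t + 9) ^ 2 / (t + 6) ^ 3) \<circ> (\<lambda>t. t ^ 2 / (t + 2)))"
  unfolding coincide_def o_def
  by (intro allI impI) (simp add: divide_simps add_nonneg_eq_0_iff less_imp_le del: distrib_left_numeral, algebra)

lemma coincide_4_4:
  "coincide
     ((\<lambda>t. t ^ 2 / (t + 32) ^ 2) \<circ> (\<lambda>t. t * (t + 8)))
     ((\<lambda>t. t * (t + 16) / (t + 8) ^ 2) \<circ> (\<lambda>t. t ^ 2 / (t + 4)))"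
  unfolding coincide_def o_def
  by (intro allI impI) (simp add: divide_simps add_nonneg_eq_0_iff less_imp_le del: distrib_left_numeral, algebra)

lemma coincide_4_9:
  "coincide
     ((\<lambda>t. t ^ 3 * (t + 8) / (t ^ 2 + 36 * t + 216) ^ 2) \<circ> (\<lambda>t. t * (t ^ 2 + 6 * t + 12)))
     ((\<lambda>t. t * (t + 8) ^ 3 / (t ^ 2 + 12 * t + 24) ^ 2) \<circ> (\<lambda>t. t ^ 3 / (t ^ 2 + 3 * t + 3)))"
  unfolding coincide_def o_def
  by (intro allI impI) (simp add: divide_simps add_nonneg_eq_0_iff less_imp_le del: distrib_left_numeral, algebra)

text \<open>The middle link between a degree-4 and a degree-2 identity.\<close>

lemma coincide_4_8:
  "coincide
     ((\<lambda>t. t ^ 2 / (t + 32) ^ 2) \<circ> (\<lambda>t. t ^ 2 / (t + 4)) \<circ> (\<lambda>t. t * (t + 4)))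
     ((\<lambda>t. t * (t + 16) / (t + 8) ^ 2) \<circ> (\<lambda>t. t ^ 2 / (t + 4)) \<circ> (\<lambda>t. t ^ 2 / (t + 2)))"
  unfolding coincide_def o_def
  by (intro allI impI) (simp add: divide_simps add_nonneg_eq_0_iff less_imp_le del: distrib_left_numeral, algebra)

text \<open>The four statements for r = 3 are the corners of a square whose sides are the degree-2
  and degree-3 identities. \<open>coincide_3_A\<close> is the common start,
  \<open>coincide_3_AB\<close> the point after degree 2, \<open>coincide_3_BA\<close> the point
  after degree 3, and \<open>coincide_3_B\<close> the common end.\<close>

lemma coincide_3_A:
  "coincide
     ((\<lambda>t. t * (t + 9) ^ 2 / (t + 6) ^ 3) \<circ> (\<lambda>t. t * (t ^ 2 + 6 * t + 12)))
     ((\<lambda>t. t * (t ^ 2 + 9 * t + 27) / (t + 3) ^ 3) \<circ> (\<lambda>t. t * (t + 3) ^ 2 / (t + 2)))"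
  unfolding coincide_def o_def
  by (intro allI impI) (simp add: divide_simps add_nonneg_eq_0_iff less_imp_le del: distrib_left_numeral, algebra)

lemma coincide_3_B:
  "coincide
     ((\<lambda>t. t ^ 2 * (t + 9) / (t + 12) ^ 3) \<circ> (\<lambda>t. t ^ 3 / (t ^ 2 + 3 * t + 3)))
     ((\<lambda>t. t ^ 3 / (t + 9) ^ 3) \<circ> (\<lambda>t. t ^ 2 * (t + 3) / (t + 2) ^ 2))"
  unfolding coincide_def o_def
  by (intro allI impI) (simp add: divide_simps add_nonneg_eq_0_iff less_imp_le del: distrib_left_numeral, algebra)

lemma coincide_3_AB:
  "coincide
     ((\<lambda>t. t * (t ^ 2 + 9 * t + 27) / (t + 3) ^ 3) \<circ> (\<lambda>t. t ^ 2 * (t + 3) / (t + 2) ^ 2))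
     ((\<lambda>t. t ^ 2 * (t + 9) / (t + 12) ^ 3) \<circ> (\<lambda>t. t * (t ^ 2 + 6 * t + 12)))"
  unfolding coincide_def o_def
  by (intro allI impI) (simp add: divide_simps add_nonneg_eq_0_iff less_imp_le del: distrib_left_numeral, algebra)

lemma coincide_3_BA:
  "coincide
     ((\<lambda>t. t ^ 3 / (t + 9) ^ 3) \<circ> (\<lambda>t. t * (t + 3) ^ 2 / (t + 2)))
     ((\<lambda>t. t * (t + 9) ^ 2 / (t + 6) ^ 3) \<circ> (\<lambda>t. t ^ 3 / (t ^ 2 + 3 * t + 3)))"
  unfolding coincide_def o_def
  by (intro allI impI) (simp add: divide_simps add_nonneg_eq_0_iff less_imp_le del: distrib_left_numeral, algebra)

text \<open>The same square for r = 4. The degree-2 side is written first here, so the point after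
  degree 2 is \<open>coincide_4_BA\<close> and the point after degree 3 is
  \<open>coincide_4_AB\<close>.\<close>

lemma coincide_4_A:
  "coincide
     ((\<lambda>t. t * (t + 16) / (t + 8) ^ 2) \<circ> (\<lambda>t. t * (t + 4) ^ 3 / (t + 3)))
     ((\<lambda>t. t * (t + 8) ^ 3 / (t ^ 2 + 12 * t + 24) ^ 2) \<circ> (\<lambda>t. t * (t + 6)))"
  unfolding coincide_def o_def
  by (intro allI impI) (simp add: divide_simps add_nonneg_eq_0_iff less_imp_le del: distrib_left_numeral, algebra)

lemma coincide_4_B:
  "coincide
     ((\<lambda>t. t ^ 2 / (t + 32) ^ 2) \<circ> (\<lambda>t. t ^ 3 * (t + 4) / (t + 3) ^ 3))
     ((\<lambda>t. t ^ 3 * (t + 8) / (t ^ 2 + 36 * t + 216) ^ 2) \<circ> (\<lambda>t. t ^ 2 / (t + 2)))"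
  unfolding coincide_def o_def
  by (intro allI impI) (simp add: divide_simps add_nonneg_eq_0_iff less_imp_le del: distrib_left_numeral, algebra)

lemma coincide_4_BA:
  "coincide
     ((\<lambda>t. t ^ 2 / (t + 32) ^ 2) \<circ> (\<lambda>t. t * (t + 4) ^ 3 / (t + 3)))
     ((\<lambda>t. t * (t + 8) ^ 3 / (t ^ 2 + 12 * t + 24) ^ 2) \<circ> (\<lambda>t. t ^ 2 / (t + 2)))"
  unfolding coincide_def o_def
  by (intro allI impI) (simp add: divide_simps add_nonneg_eq_0_iff less_imp_le del: distrib_left_numeral, algebra)

lemma coincide_4_AB:
  "coincide
     ((\<lambda>t. t * (t + 16) / (t + 8) ^ 2) \<circ> (\<lambda>t. t ^ 3 * (t + 4) / (t + 3) ^ 3))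
     ((\<lambda>t. t ^ 3 * (t + 8) / (t ^ 2 + 36 * t + 216) ^ 2) \<circ> (\<lambda>t. t * (t + 6)))"
  unfolding coincide_def o_def
  by (intro allI impI) (simp add: divide_simps add_nonneg_eq_0_iff less_imp_le del: distrib_left_numeral, algebra)

section \<open>Identities of composite and fractional degree\<close>

lemma modular_identity_cong:
  assumes "modular_identity r N A M B" "coincide A' A" "coincide B' B"
  shows "modular_identity r N A' M B'"
  using assms by (simp add: modular_identity_def coincide_def)

lemma coincide_refl: "coincide f f" and coincide_sym: "coincide f g \<Longrightarrow> coincide g f"
  by (simp_all add: coincide_def)

text \<open>The real \<open>sqrt\<close> is multiplicative on all of the reals, so comparing
  radicands brings no sign conditions.\<close>

lemma sqrt_eq_mult: "x = y * z \<Longrightarrow> sqrt x = sqrt y * sqrt z"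
  by (simp add: real_sqrt_mult)

text \<open>The degree-2 identity at t(t + 4) is followed by itself at t^2/(t + 2). In the product
  of the multipliers the factor t^2 + 4t + 8 cancels.\<close>

lemma modular_identity_2_4:
  "modular_identity 2 4
     ((\<lambda>t. t * (t + 8) / (t + 4) ^ 2) \<circ> (\<lambda>t. t * (t + 4)))
     (\<lambda>t. ((t + 2) / (t + 4)) ^ 2)
     ((\<lambda>t. t ^ 2 / (t + 8) ^ 2) \<circ> (\<lambda>t. t ^ 2 / (t + 2)))"
  by (rule modular_identity_trans[OF modular_identity_compose[OF modular_identity_2_2]
        modular_identity_compose[OF modular_identity_2_2]],
      simp add: add_pos_pos, simp add: add_pos_pos, rule coincide_2_4, simp,
      (simp only: o_def, simp add: divide_simps add_nonneg_eq_0_iff less_imp_le del: distrib_left_numeral, algebra))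

lemma modular_identity_3_4:
  "modular_identity 3 4
     ((\<lambda>t. t * (t + 9) ^ 2 / (t + 6) ^ 3) \<circ> (\<lambda>t. t * (t + 6)))
     (\<lambda>t. (t ^ 2 + 6 * t + 6) / (t ^ 2 + 12 * t + 24))
     ((\<lambda>t. t ^ 2 * (t + 9) / (t + 12) ^ 3) \<circ> (\<lambda>t. t ^ 2 / (t + 2)))"
  by (rule modular_identity_trans[OF modular_identity_compose[OF modular_identity_3_2]
        modular_identity_compose[OF modular_identity_3_2]],
      simp add: add_pos_pos, simp add: add_pos_pos, rule coincide_3_4, simp,
      (simp only: o_def, simp add: divide_simps add_nonneg_eq_0_iff less_imp_le del: distrib_left_numeral, algebra))

lemma modular_identity_4_4:
  "modular_identity 4 4
     ((\<lambda>t. t * (t + 16) / (t + 8) ^ 2) \<circ> (\<lambda>t. t * (t + 8)))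
     (\<lambda>t. sqrt ((t ^ 2 + 8 * t + 8) / (t ^ 2 + 32 * t + 128)))
     ((\<lambda>t. t ^ 2 / (t + 32) ^ 2) \<circ> (\<lambda>t. t ^ 2 / (t + 4)))"
  by (rule modular_identity_trans[OF modular_identity_compose[OF modular_identity_4_2]
        modular_identity_compose[OF modular_identity_4_2]],
      simp add: add_pos_pos, simp add: add_pos_pos, rule coincide_4_4, simp,
      (simp only: o_def, rule sqrt_eq_mult, simp add: divide_simps add_nonneg_eq_0_iff less_imp_le del: distrib_left_numeral, algebra))

lemma modular_identity_4_9:
  "modular_identity 4 9
     ((\<lambda>t. t * (t + 8) ^ 3 / (t ^ 2 + 12 * t + 24) ^ 2) \<circ> (\<lambda>t. t * (t ^ 2 + 6 * t + 12)))
     (\<lambda>t. sqrt ((t ^ 6 + 12 * t ^ 5 + 60 * t ^ 4 + 156 * t ^ 3 + 216 * t ^ 2 + 144 * t + 24) / (t ^ 6 + 36 * t ^ 5 + 324 * t ^ 4 + 1404 * t ^ 3 + 3240 * t ^ 2 + 3888 * t + 1944)))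
     ((\<lambda>t. t ^ 3 * (t + 8) / (t ^ 2 + 36 * t + 216) ^ 2) \<circ> (\<lambda>t. t ^ 3 / (t ^ 2 + 3 * t + 3)))"
  by (rule modular_identity_trans[OF modular_identity_compose[OF modular_identity_4_3]
        modular_identity_compose[OF modular_identity_4_3]],
      simp add: add_pos_pos, simp add: add_pos_pos, rule coincide_4_9, simp,
      (simp only: o_def, rule sqrt_eq_mult, simp add: divide_simps add_nonneg_eq_0_iff less_imp_le del: distrib_left_numeral, algebra))

text \<open>Degree 4 at t(t + 4), then degree 2 at t^2/(t + 4) after t^2/(t + 2).\<close>

lemma modular_identity_4_8:
  "modular_identity 4 8
     ((\<lambda>t. t * (t + 16) / (t + 8) ^ 2) \<circ> (\<lambda>t. t * (t + 8)) \<circ> (\<lambda>t. t * (t + 4)))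
     (\<lambda>t. sqrt ((t ^ 4 + 8 * t ^ 3 + 24 * t ^ 2 + 32 * t + 8) / (t ^ 4 + 32 * t ^ 3 + 192 * t ^ 2 + 512 * t + 512)))
     ((\<lambda>t. t ^ 2 / (t + 32) ^ 2) \<circ> (\<lambda>t. t ^ 2 / (t + 4)) \<circ> (\<lambda>t. t ^ 2 / (t + 2)))"
  by (rule modular_identity_trans[OF modular_identity_compose[OF modular_identity_4_4]
        modular_identity_compose[OF modular_identity_compose[OF modular_identity_4_2]]],
      simp add: add_pos_pos, simp add: add_pos_pos, simp add: add_pos_pos, rule coincide_4_8, simp,
      (simp only: o_def, rule sqrt_eq_mult, simp add: divide_simps add_nonneg_eq_0_iff less_imp_le del: distrib_left_numeral, algebra))

lemma modular_identity_3_6: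
  "modular_identity 3 6
     ((\<lambda>t. t * (t + 9) ^ 2 / (t + 6) ^ 3) \<circ> (\<lambda>t. t * (t ^ 2 + 6 * t + 12)))
     (\<lambda>t. (t ^ 3 + 6 * t ^ 2 + 12 * t + 6) / (t ^ 3 + 12 * t ^ 2 + 36 * t + 36))
     ((\<lambda>t. t ^ 2 * (t + 9) / (t + 12) ^ 3) \<circ> (\<lambda>t. t ^ 3 / (t ^ 2 + 3 * t + 3)))"
  by (rule modular_identity_cong[OF modular_identity_trans[OF modular_identity_compose[OF modular_identity_3_2]
        modular_identity_compose[OF modular_identity_3_3]]
        coincide_refl coincide_3_B],
      simp add: add_pos_pos, simp add: add_pos_pos, rule coincide_sym[OF coincide_3_AB], simp,
      (simp only: o_def, simp add: divide_simps add_nonneg_eq_0_iff less_imp_le del: distrib_left_numeral, algebra))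

lemma modular_identity_4_6:
  "modular_identity 4 6
     ((\<lambda>t. t * (t + 16) / (t + 8) ^ 2) \<circ> (\<lambda>t. t * (t + 4) ^ 3 / (t + 3)))
     (\<lambda>t. sqrt ((t ^ 4 + 12 * t ^ 3 + 48 * t ^ 2 + 72 * t + 24) / (t ^ 4 + 36 * t ^ 3 + 288 * t ^ 2 + 864 * t + 864)))
     ((\<lambda>t. t ^ 2 / (t + 32) ^ 2) \<circ> (\<lambda>t. t ^ 3 * (t + 4) / (t + 3) ^ 3))"
  by (rule modular_identity_cong[OF modular_identity_trans[OF modular_identity_compose[OF modular_identity_4_2]
        modular_identity_compose[OF modular_identity_4_3]]
        coincide_refl coincide_4_B],
      simp add: add_pos_pos, simp add: add_pos_pos, rule coincide_4_BA, simp,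
      (simp only: o_def, rule sqrt_eq_mult, simp add: divide_simps add_nonneg_eq_0_iff less_imp_le del: distrib_left_numeral, algebra))

text \<open>The diagonal of the square: from the start \<open>coincide_3_A\<close>, the degree-3
  side is divided by the degree-2 side.\<close>

lemma modular_identity_3_three_halves:
  "modular_identity 3 (3 / 2)
     ((\<lambda>t. t * (t ^ 2 + 9 * t + 27) / (t + 3) ^ 3) \<circ> (\<lambda>t. t ^ 2 * (t + 3) / (t + 2) ^ 2))
     (\<lambda>t. (t ^ 3 + 6 * t ^ 2 + 12 * t + 12) / (t ^ 3 + 6 * t ^ 2 + 18 * t + 18))
     ((\<lambda>t. t ^ 3 / (t + 9) ^ 3) \<circ> (\<lambda>t. t * (t + 3) ^ 2 / (t + 2)))"
  by (rule modular_identity_cong[OF modular_identity_quotient[OF modular_identity_compose[OF modular_identity_3_2]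
        modular_identity_compose[OF modular_identity_3_3]]
        coincide_3_AB coincide_refl],
      simp add: add_pos_pos, simp add: add_pos_pos, rule coincide_3_A, simp, simp,
      simp add: add_pos_pos, (simp only: o_def, simp add: divide_simps add_nonneg_eq_0_iff less_imp_le del: distrib_left_numeral, algebra))

text \<open>The same diagonal for r = 4. Division asks for M1 M = M2 with the product on the left,
  so \<open>sqrt_eq_mult\<close> is applied in reverse.\<close>

lemma modular_identity_4_three_halves:
  "modular_identity 4 (3 / 2)
     ((\<lambda>t. t ^ 2 / (t + 32) ^ 2) \<circ> (\<lambda>t. t * (t + 4) ^ 3 / (t + 3)))
     (\<lambda>t. sqrt ((t ^ 4 + 12 * t ^ 3 + 48 * t ^ 2 + 96 * t + 96) / (t ^ 4 + 12 * t ^ 3 + 72 * t ^ 2 + 216 * t + 216)))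
     ((\<lambda>t. t * (t + 16) / (t + 8) ^ 2) \<circ> (\<lambda>t. t ^ 3 * (t + 4) / (t + 3) ^ 3))"
  by (rule modular_identity_cong[OF modular_identity_quotient[OF modular_identity_compose[OF modular_identity_4_2]
        modular_identity_compose[OF modular_identity_4_3]]
        coincide_refl coincide_4_AB],
      simp add: add_pos_pos, simp add: add_pos_pos, rule coincide_4_A, simp, simp,
      simp add: add_pos_pos, (simp only: o_def, rule sqrt_eq_mult[symmetric], simp add: divide_simps add_nonneg_eq_0_iff less_imp_le del: distrib_left_numeral, algebra))

theorem theorem9p2:
  shows "modular_identity 2 2
        (\<lambda>t. t * (t + 8) / (t + 4) ^ 2)
        (\<lambda>t. (t + 4) / (t + 8))
        (\<lambda>t. t ^ 2 / (t + 8) ^ 2) \<and>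
     modular_identity 2 3
        (\<lambda>t. t * (t + 4) ^ 3 / ((t + 2) ^ 3 * (t + 6)))
        (\<lambda>t. (t + 2) / (t + 6))
        (\<lambda>t. t ^ 3 * (t + 4) / ((t + 2) * (t + 6) ^ 3)) \<and>
     modular_identity 2 4
        ((\<lambda>t. t * (t + 8) / (t + 4) ^ 2) \<circ> (\<lambda>t. t * (t + 4)))
        (\<lambda>t. ((t + 2) / (t + 4)) ^ 2)
        ((\<lambda>t. t ^ 2 / (t + 8) ^ 2) \<circ> (\<lambda>t. t ^ 2 / (t + 2))) \<and>
     modular_identity 3 2
        (\<lambda>t. t * (t + 9) ^ 2 / (t + 6) ^ 3)
        (\<lambda>t. (t + 6) / (t + 12))
        (\<lambda>t. t ^ 2 * (t + 9) / (t + 12) ^ 3) \<and>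
     modular_identity 3 3
        (\<lambda>t. t * (t ^ 2 + 9 * t + 27) / (t + 3) ^ 3)
        (\<lambda>t. (t + 3) / (t + 9))
        (\<lambda>t. t ^ 3 / (t + 9) ^ 3) \<and>
     modular_identity 3 4
        ((\<lambda>t. t * (t + 9) ^ 2 / (t + 6) ^ 3) \<circ> (\<lambda>t. t * (t + 6)))
        (\<lambda>t. (t ^ 2 + 6 * t + 6) / (t ^ 2 + 12 * t + 24))
        ((\<lambda>t. t ^ 2 * (t + 9) / (t + 12) ^ 3) \<circ> (\<lambda>t. t ^ 2 / (t + 2))) \<and>
     modular_identity 3 6
        ((\<lambda>t. t * (t + 9) ^ 2 / (t + 6) ^ 3) \<circ> (\<lambda>t. t * (t ^ 2 + 6 * t + 12)))
        (\<lambda>t. (t ^ 3 + 6 * t ^ 2 + 12 * t + 6) / (t ^ 3 + 12 * t ^ 2 + 36 * t + 36))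
        ((\<lambda>t. t ^ 2 * (t + 9) / (t + 12) ^ 3) \<circ> (\<lambda>t. t ^ 3 / (t ^ 2 + 3 * t + 3))) \<and>
     coincide
        ((\<lambda>t. t * (t + 9) ^ 2 / (t + 6) ^ 3) \<circ> (\<lambda>t. t * (t ^ 2 + 6 * t + 12)))
        ((\<lambda>t. t * (t ^ 2 + 9 * t + 27) / (t + 3) ^ 3) \<circ> (\<lambda>t. t * (t + 3) ^ 2 / (t + 2))) \<and>
     coincide
        ((\<lambda>t. t ^ 2 * (t + 9) / (t + 12) ^ 3) \<circ> (\<lambda>t. t ^ 3 / (t ^ 2 + 3 * t + 3)))
        ((\<lambda>t. t ^ 3 / (t + 9) ^ 3) \<circ> (\<lambda>t. t ^ 2 * (t + 3) / (t + 2) ^ 2)) \<and>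
     modular_identity 4 2
        (\<lambda>t. t * (t + 16) / (t + 8) ^ 2)
        (\<lambda>t. sqrt ((t + 8) / (t + 32)))
        (\<lambda>t. t ^ 2 / (t + 32) ^ 2) \<and>
     modular_identity 4 3
        (\<lambda>t. t * (t + 8) ^ 3 / (t ^ 2 + 12 * t + 24) ^ 2)
        (\<lambda>t. sqrt ((t ^ 2 + 12 * t + 24) / (t ^ 2 + 36 * t + 216)))
        (\<lambda>t. t ^ 3 * (t + 8) / (t ^ 2 + 36 * t + 216) ^ 2) \<and>
     modular_identity 4 4
        ((\<lambda>t. t * (t + 16) / (t + 8) ^ 2) \<circ> (\<lambda>t. t * (t + 8)))
        (\<lambda>t. sqrt ((t ^ 2 + 8 * t + 8) / (t ^ 2 + 32 * t + 128)))
        ((\<lambda>t. t ^ 2 / (t + 32) ^ 2) \<circ> (\<lambda>t. t ^ 2 / (t + 4))) \<and>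
     modular_identity 4 5
        (\<lambda>t. t * (t + 4) ^ 5 / ((t ^ 2 + 6 * t + 4) ^ 2 * (t ^ 2 + 8 * t + 20)))
        (\<lambda>t. sqrt ((t ^ 2 + 6 * t + 4) / (t ^ 2 + 30 * t + 100)))
        (\<lambda>t. t ^ 5 * (t + 4) / ((t ^ 2 + 8 * t + 20) * (t ^ 2 + 30 * t + 100) ^ 2)) \<and>
     modular_identity 4 6
        ((\<lambda>t. t * (t + 16) / (t + 8) ^ 2) \<circ> (\<lambda>t. t * (t + 4) ^ 3 / (t + 3)))
        (\<lambda>t. sqrt ((t ^ 4 + 12 * t ^ 3 + 48 * t ^ 2 + 72 * t + 24) / (t ^ 4 + 36 * t ^ 3 + 288 * t ^ 2 + 864 * t + 864)))
        ((\<lambda>t. t ^ 2 / (t + 32) ^ 2) \<circ> (\<lambda>t. t ^ 3 * (t + 4) / (t + 3) ^ 3)) \<and>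
     coincide
        ((\<lambda>t. t * (t + 16) / (t + 8) ^ 2) \<circ> (\<lambda>t. t * (t + 4) ^ 3 / (t + 3)))
        ((\<lambda>t. t * (t + 8) ^ 3 / (t ^ 2 + 12 * t + 24) ^ 2) \<circ> (\<lambda>t. t * (t + 6))) \<and>
     coincide
        ((\<lambda>t. t ^ 2 / (t + 32) ^ 2) \<circ> (\<lambda>t. t ^ 3 * (t + 4) / (t + 3) ^ 3))
        ((\<lambda>t. t ^ 3 * (t + 8) / (t ^ 2 + 36 * t + 216) ^ 2) \<circ> (\<lambda>t. t ^ 2 / (t + 2))) \<and>
     modular_identity 4 8
        ((\<lambda>t. t * (t + 16) / (t + 8) ^ 2) \<circ> (\<lambda>t. t * (t + 8)) \<circ> (\<lambda>t. t * (t + 4)))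
        (\<lambda>t. sqrt ((t ^ 4 + 8 * t ^ 3 + 24 * t ^ 2 + 32 * t + 8) / (t ^ 4 + 32 * t ^ 3 + 192 * t ^ 2 + 512 * t + 512)))
        ((\<lambda>t. t ^ 2 / (t + 32) ^ 2) \<circ> (\<lambda>t. t ^ 2 / (t + 4)) \<circ> (\<lambda>t. t ^ 2 / (t + 2))) \<and>
     modular_identity 4 9
        ((\<lambda>t. t * (t + 8) ^ 3 / (t ^ 2 + 12 * t + 24) ^ 2) \<circ> (\<lambda>t. t * (t ^ 2 + 6 * t + 12)))
        (\<lambda>t. sqrt ((t ^ 6 + 12 * t ^ 5 + 60 * t ^ 4 + 156 * t ^ 3 + 216 * t ^ 2 + 144 * t + 24) / (t ^ 6 + 36 * t ^ 5 + 324 * t ^ 4 + 1404 * t ^ 3 + 3240 * t ^ 2 + 3888 * t + 1944)))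
        ((\<lambda>t. t ^ 3 * (t + 8) / (t ^ 2 + 36 * t + 216) ^ 2) \<circ> (\<lambda>t. t ^ 3 / (t ^ 2 + 3 * t + 3))) \<and>
     modular_identity 3 (3 / 2)
        ((\<lambda>t. t * (t ^ 2 + 9 * t + 27) / (t + 3) ^ 3) \<circ> (\<lambda>t. t ^ 2 * (t + 3) / (t + 2) ^ 2))
        (\<lambda>t. (t ^ 3 + 6 * t ^ 2 + 12 * t + 12) / (t ^ 3 + 6 * t ^ 2 + 18 * t + 18))
        ((\<lambda>t. t ^ 3 / (t + 9) ^ 3) \<circ> (\<lambda>t. t * (t + 3) ^ 2 / (t + 2))) \<and>
     coincide
        ((\<lambda>t. t * (t ^ 2 + 9 * t + 27) / (t + 3) ^ 3) \<circ> (\<lambda>t. t ^ 2 * (t + 3) / (t + 2) ^ 2))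
        ((\<lambda>t. t ^ 2 * (t + 9) / (t + 12) ^ 3) \<circ> (\<lambda>t. t * (t ^ 2 + 6 * t + 12))) \<and>
     coincide
        ((\<lambda>t. t ^ 3 / (t + 9) ^ 3) \<circ> (\<lambda>t. t * (t + 3) ^ 2 / (t + 2)))
        ((\<lambda>t. t * (t + 9) ^ 2 / (t + 6) ^ 3) \<circ> (\<lambda>t. t ^ 3 / (t ^ 2 + 3 * t + 3))) \<and>
     modular_identity 4 (3 / 2)
        ((\<lambda>t. t ^ 2 / (t + 32) ^ 2) \<circ> (\<lambda>t. t * (t + 4) ^ 3 / (t + 3)))
        (\<lambda>t. sqrt ((t ^ 4 + 12 * t ^ 3 + 48 * t ^ 2 + 96 * t + 96) / (t ^ 4 + 12 * t ^ 3 + 72 * t ^ 2 + 216 * t + 216)))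
        ((\<lambda>t. t * (t + 16) / (t + 8) ^ 2) \<circ> (\<lambda>t. t ^ 3 * (t + 4) / (t + 3) ^ 3)) \<and>
     coincide
        ((\<lambda>t. t ^ 2 / (t + 32) ^ 2) \<circ> (\<lambda>t. t * (t + 4) ^ 3 / (t + 3)))
        ((\<lambda>t. t * (t + 8) ^ 3 / (t ^ 2 + 12 * t + 24) ^ 2) \<circ> (\<lambda>t. t ^ 2 / (t + 2))) \<and>
     coincide
        ((\<lambda>t. t * (t + 16) / (t + 8) ^ 2) \<circ> (\<lambda>t. t ^ 3 * (t + 4) / (t + 3) ^ 3))
        ((\<lambda>t. t ^ 3 * (t + 8) / (t ^ 2 + 36 * t + 216) ^ 2) \<circ> (\<lambda>t. t * (t + 6)))"
  by (intro conjI modular_identity_2_2 modular_identity_2_3 modular_identity_2_4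
      modular_identity_3_2 modular_identity_3_3 modular_identity_3_4 modular_identity_3_6
      modular_identity_4_2 modular_identity_4_3 modular_identity_4_4 modular_identity_4_5
      modular_identity_4_6 modular_identity_4_8 modular_identity_4_9
      modular_identity_3_three_halves modular_identity_4_three_halves
      coincide_3_A coincide_3_B coincide_3_AB coincide_3_BA
      coincide_4_A coincide_4_B coincide_4_BA coincide_4_AB)

end
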